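(* Let $n\ge 5$ be an integer. Then \[ M(n,2,r)=\begin{cases} \binom{n-1}{2}+1 & \text{if } r=2,\\ 2(r-2)+\binom{n-r+1}{2}+1 & \text{if } 3\le r\le n-4 \text{ and } n-r-2\ge r,\\ 2(r-2)+\binom{n-r+1}{2} & \text{if } 3\le r\le n-4 \text{ and } n-r-2<r,\\ 7 & \text{if } r=n-3,\\ 4 & \text{if } r=n-2. \end{cases} \]
   Context: All graphs are finite and simple. For a vertex $u$ of a graph $G$, $N[u]$ is its closed neighborhood (the set consisting of $u$ and all vertices adjacent to $u$). A set $S\subseteq V(G)$ is dominating if every vertex of $G$ lies in $N[s]$ for some $s\in S$. A vertex $u\in V(G)$ is overdominated by $S$ if $|N[u]\cap S|\ge 2$. The cardinality-redundance $CR(S)$ is the number of vertices of $G$ overdominated by $S$, and $CR(G)$ is the minimum of $CR(S)$ over all dominating sets $S$ of $G$. $\gamma_{CR}(G)$ is the minimum size of a dominating set $S$ with $CR(S)=CR(G)$. For integers $k\ge 0$ and $n,r\ge 1$ with $k\le n$, $r\le n$, $M(n,k,r)$ is the maximum of $|E(G)|$ over all graphs $G$ with $|V(G)|=n$, $CR(G)=k$ and $\gamma_{CR}(G)=r$; if no such graph exists, $M(n,k,r)=0$. *)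

theory Defs
  imports Main
begin

text \<open>A finite simple graph is a pair of a finite vertex set and a set of two-element
  subsets of it.\<close>

definition simple_graph :: "'a set \<Rightarrow> 'a set set \<Rightarrow> bool" where
  "simple_graph V E \<longleftrightarrow> finite V \<and> (\<forall>e\<in>E. e \<subseteq> V \<and> card e = 2)"

definition closed_nbhd :: "'a set \<Rightarrow> 'a set set \<Rightarrow> 'a \<Rightarrow> 'a set" where
  "closed_nbhd V E u = insert u {v \<in> V. {u, v} \<in> E}"

definition dominating :: "'a set \<Rightarrow> 'a set set \<Rightarrow> 'a set \<Rightarrow> bool" where
  "dominating V E S \<longleftrightarrow> S \<subseteq> V \<and> (\<forall>v\<in>V. \<exists>s\<in>S. v \<in> closed_nbhd V E s)"

definition overdominated :: "'a set \<Rightarrow> 'a set set \<Rightarrow> 'a set \<Rightarrow> 'a \<Rightarrow> bool" where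
  "overdominated V E S u \<longleftrightarrow> u \<in> V \<and> card (closed_nbhd V E u \<inter> S) \<ge> 2"

definition CR_set :: "'a set \<Rightarrow> 'a set set \<Rightarrow> 'a set \<Rightarrow> nat" where
  "CR_set V E S = card {u. overdominated V E S u}"

text \<open>The sets under \<open>Min\<close> below are finite and nonempty for a simple graph:
  \<open>V\<close> itself is dominating.\<close>

definition CR :: "'a set \<Rightarrow> 'a set set \<Rightarrow> nat" where
  "CR V E = Min {CR_set V E S | S. dominating V E S}"

definition gamma_CR :: "'a set \<Rightarrow> 'a set set \<Rightarrow> nat" where
  "gamma_CR V E = Min {card S | S. dominating V E S \<and> CR_set V E S = CR V E}"

text \<open>Vertices are taken in \<open>nat\<close>, which is no restriction: every finite graph is
  isomorphic to one whose vertices are natural numbers.  The set of sizes is finite, as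
  a graph on \<open>n\<close> vertices has at most \<open>n choose 2\<close> edges.\<close>

definition graph_sizes :: "nat \<Rightarrow> nat \<Rightarrow> nat \<Rightarrow> nat set" where
  "graph_sizes n k r = {card E | (V :: nat set) E.
     simple_graph V E \<and> card V = n \<and> CR V E = k \<and> gamma_CR V E = r}"

definition M :: "nat \<Rightarrow> nat \<Rightarrow> nat \<Rightarrow> nat" where
  "M n k r = (if graph_sizes n k r = {} then 0 else Max (graph_sizes n k r))"

end

theory Submission
  imports Defs
begin

text \<open>Let \<open>CR(G) = 2\<close> and let \<open>S\<close> be an optimal set: dominating, with \<open>r\<close> elements, exactly
  two overdominated vertices \<open>x\<close> and \<open>y\<close>, and of minimum size among the dominating sets with
  at most two overdominated vertices.  Every other vertex outside \<open>S\<close> has exactly one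
  neighbour in \<open>S\<close>.  An edge inside \<open>S\<close> overdominates both its ends, so there are two cases.

  If \<open>S\<close> contains an edge, that edge is \<open>xy\<close>, and counting gives at most
  \<open>1 + (n - r) + (n - r choose 2)\<close> edges, which is enough for every \<open>r \<ge> 2\<close>.

  Otherwise \<open>S\<close> is independent and \<open>x, y\<close> lie outside \<open>S\<close>.  Then there are at most
  \<open>(n - r choose 2) + (n - r - 2) + 2 r\<close> edges, and the bounds follow by counting how many
  edges are missing from this maximum.  Since \<open>CR(G) \<noteq> 0\<close>, neither \<open>x\<close> nor \<open>y\<close> is universal,
  so at least one edge is missing, and if only one is missing, it is \<open>xy\<close>.  In that case,
  if some \<open>s \<in> S\<close> had no neighbour outside \<open>S \<union> {x, y}\<close>, then \<open>{x, s}\<close> would be dominating with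
  two overdominated vertices, contrary to minimality when \<open>r \<ge> 3\<close>; hence
  \<open>n - r - 2 \<ge> r\<close> (lemmas \<open>missing_edges\<close> and \<open>missing_one_private\<close>).
  If \<open>n - r\<close> is 2 or 3, the degrees of \<open>x\<close> and \<open>y\<close> into \<open>S\<close> are bounded by exchange arguments:
  the neighbours of \<open>x\<close> in \<open>S\<close> are replaced in \<open>S\<close> by \<open>x\<close> alone, or by \<open>x\<close> and one more vertex
  (lemmas \<open>exchange_x\<close>, \<open>exchange_x_with\<close>, \<open>two_outside\<close>, \<open>card_edges_le_7\<close>).

  The extremal graphs are of two kinds.  For \<open>r = 2\<close>, \<open>r = n - 3\<close> and \<open>r = n - 2\<close>, take a clique on
  \<open>m - 2\<close> vertices and an edge \<open>uv\<close>, join each clique vertex to exactly one of \<open>u, v\<close>, using both,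
  and add \<open>n - m\<close> isolated vertices, where \<open>m\<close> is \<open>n\<close>, 5 and 4 respectively
  (theorem \<open>split_edges_attains\<close>).  For \<open>3 \<le> r \<le> n - 4\<close>, take an independent set \<open>S\<close> of size \<open>r\<close>
  joined completely to two hubs, a clique \<open>P\<close> on the other vertices, each with one neighbour in \<open>S\<close>, and join
  the hubs to \<open>P\<close> and to each other, leaving out one or two edges (locale \<open>two_hubs\<close>).\<close>

section \<open>Closed neighbourhoods, domination and overdomination\<close>

lemma mem_closed_nbhd:
  assumes "simple_graph V E"
  shows "v \<in> closed_nbhd V E u \<longleftrightarrow> v = u \<or> {u, v} \<in> E"
  using assms by (auto simp: simple_graph_def closed_nbhd_def)

lemma edge_cases:
  assumes "simple_graph V E" "e \<in> E"
  obtains a b where "e = {a, b}" "a \<noteq> b" "a \<in> V" "b \<in> V"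
proof -
  have "card e = 2" "e \<subseteq> V" using assms by (auto simp: simple_graph_def)
  then show thesis using that by (auto simp: card_2_iff)
qed

lemma edgeD:
  assumes "simple_graph V E" "{a, b} \<in> E"
  shows "a \<noteq> b" "a \<in> V" "b \<in> V"
  using assms by (auto simp: simple_graph_def card_2_iff doubleton_eq_iff)

lemma dominating_iff:
  assumes "simple_graph V E"
  shows "dominating V E S \<longleftrightarrow> S \<subseteq> V \<and> (\<forall>v\<in>V. v \<in> S \<or> (\<exists>s\<in>S. {s, v} \<in> E))"
  using assms by (auto simp: dominating_def mem_closed_nbhd)

lemma card_ge_2_iff:
  assumes "finite A"
  shows "card A \<ge> 2 \<longleftrightarrow> (\<exists>s\<in>A. \<exists>t\<in>A. s \<noteq> t)"
  using assms by (metis One_nat_def Suc_1 card_le_Suc0_iff_eq not_less_eq_eq)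

lemma overdominated_iff:
  assumes "simple_graph V E" "S \<subseteq> V"
  shows "overdominated V E S u \<longleftrightarrow> u \<in> V \<and>
    (\<exists>s\<in>S. \<exists>t\<in>S. s \<noteq> t \<and> (s = u \<or> {u, s} \<in> E) \<and> (t = u \<or> {u, t} \<in> E))"
proof -
  have "finite (closed_nbhd V E u \<inter> S)"
    using assms by (meson finite_Int finite_subset simple_graph_def)
  then show ?thesis
    unfolding overdominated_def
    by (simp add: card_ge_2_iff Bex_def mem_closed_nbhd[OF assms(1)]) metis
qed

lemma not_overdominated_unique:
  assumes g: "simple_graph V E" and "S \<subseteq> V" "v \<in> V" "dominating V E S"
    and nov: "\<not> overdominated V E S v"
  shows "\<exists>!s. s \<in> S \<and> (s = v \<or> {v, s} \<in> E)"
proof -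
  obtain s where "s \<in> S" "s = v \<or> {v, s} \<in> E"
    using assms by (metis dominating_iff insert_commute)
  then show ?thesis
    using nov assms(3) unfolding overdominated_iff[OF g assms(2)] by blast
qed

lemma finite_overdominated:
  assumes "simple_graph V E"
  shows "finite {u. overdominated V E S u}"
  using assms by (auto simp: simple_graph_def overdominated_def)

lemma CR_set_ge:
  assumes "simple_graph V E" "A \<subseteq> {u. overdominated V E S u}"
  shows "card A \<le> CR_set V E S"
  unfolding CR_set_def using assms by (intro card_mono finite_overdominated)

lemma finite_dominating:
  assumes "simple_graph V E"
  shows "finite {S. dominating V E S}"
  by (rule finite_subset[of _ "Pow V"]) (use assms in \<open>auto simp: simple_graph_def dominating_def\<close>)

lemma finite_CR_values:
  assumes "simple_graph V E"
  shows "finite {CR_set V E S | S. dominating V E S}"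
    and "finite {card S | S. dominating V E S \<and> CR_set V E S = k}"
proof -
  show "finite {CR_set V E S | S. dominating V E S}"
    using finite_dominating[OF assms] by (rule finite_image_set)
  have "finite {S. dominating V E S \<and> CR_set V E S = k}"
    using finite_dominating[OF assms] by (rule rev_finite_subset) auto
  then show "finite {card S | S. dominating V E S \<and> CR_set V E S = k}"
    by (rule finite_image_set)
qed

text \<open>The hypothesis on \<open>T\<close> says at once that no dominating set overdominates fewer than \<open>k\<close>
  vertices, and that those that overdominate exactly \<open>k\<close> have at least \<open>r\<close> elements.\<close>

lemma CR_gamma_eqI:
  assumes g: "simple_graph V E" and S: "dominating V E S" "CR_set V E S = k" "card S = r"
    and min: "\<And>T. dominating V E T \<Longrightarrow> CR_set V E T \<le> k \<Longrightarrow> CR_set V E T = k \<and> r \<le> card T"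
  shows "CR V E = k" "gamma_CR V E = r"
proof -
  show 1: "CR V E = k"
    unfolding CR_def
    by (intro Min_eqI finite_CR_values[OF g]) (use S min nat_le_linear in \<open>auto, metis order_refl\<close>)
  show "gamma_CR V E = r"
    unfolding gamma_CR_def 1
    by (intro Min_eqI finite_CR_values[OF g]) (use S min in auto)
qed

lemma CR_gamma_witness:
  assumes g: "simple_graph V E"
  obtains S where "dominating V E S" "CR_set V E S = CR V E" "card S = gamma_CR V E"
    "\<And>T. dominating V E T \<Longrightarrow> CR_set V E T \<le> CR V E \<Longrightarrow> card S \<le> card T"
proof -
  have V: "dominating V E V" using dominating_iff[OF g] by blast
  let ?A = "{CR_set V E S | S. dominating V E S}"
  have "CR V E \<in> ?A"
    unfolding CR_def using V by (intro Min_in finite_CR_values[OF g]) auto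
  then obtain S0 where S0: "dominating V E S0" "CR_set V E S0 = CR V E" by auto
  let ?B = "{card S | S. dominating V E S \<and> CR_set V E S = CR V E}"
  have "gamma_CR V E \<in> ?B"
    unfolding gamma_CR_def using S0 by (intro Min_in finite_CR_values[OF g]) auto
  then obtain S where S: "dominating V E S" "CR_set V E S = CR V E" "card S = gamma_CR V E"
    by auto
  have "card S \<le> card T" if "dominating V E T" "CR_set V E T \<le> CR V E" for T
  proof -
    have "CR V E \<le> CR_set V E T"
      unfolding CR_def using that by (intro Min_le finite_CR_values[OF g]) auto
    with that have "card T \<in> ?B" by auto
    then show ?thesis
      unfolding S(3) gamma_CR_def by (intro Min_le finite_CR_values[OF g])
  qed
  with S show thesis using that by blast
qed

lemma M_eqI:
  assumes "b \<in> graph_sizes n k r" "\<And>e. e \<in> graph_sizes n k r \<Longrightarrow> e \<le> b"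
  shows "M n k r = b"
proof -
  have "finite (graph_sizes n k r)"
    using assms(2) by (meson finite_nat_set_iff_bounded_le)
  then show ?thesis using assms by (auto simp: M_def intro!: Max_eqI)
qed

section \<open>Counting edges relative to a vertex set\<close>

lemma card_edges_split:
  assumes g: "simple_graph V E" and S: "S \<subseteq> V"
  shows "card E = card {e \<in> E. e \<subseteq> S} + card {e \<in> E. e \<subseteq> V - S}
    + (\<Sum>w\<in>V - S. card {s \<in> S. {w, s} \<in> E})"
proof -
  have fV: "finite V" using g by (simp add: simple_graph_def)
  have fE: "finite E"
    by (rule finite_subset[of _ "Pow V"]) (use g in \<open>auto simp: simple_graph_def\<close>)
  define C where "C = (\<lambda>(w, s). {w, s}) ` (SIGMA w:V - S. {s \<in> S. {w, s} \<in> E})"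
  have E: "E = {e \<in> E. e \<subseteq> S} \<union> {e \<in> E. e \<subseteq> V - S} \<union> C"
  proof (intro equalityI subsetI)
    fix e assume e: "e \<in> E"
    obtain a b where ab: "e = {a, b}" "a \<noteq> b" "a \<in> V" "b \<in> V" using edge_cases[OF g e] .
    show "e \<in> {e \<in> E. e \<subseteq> S} \<union> {e \<in> E. e \<subseteq> V - S} \<union> C"
    proof (cases "a \<in> S"; cases "b \<in> S")
      assume "a \<in> S" "b \<notin> S"
      then have "e \<in> C" using ab e unfolding C_def
        by (intro image_eqI[of _ _ "(b, a)"]) (auto simp: insert_commute)
      then show ?thesis by simp
    next
      assume "a \<notin> S" "b \<in> S"
      then have "e \<in> C" using ab e unfolding C_def
        by (intro image_eqI[of _ _ "(a, b)"]) auto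
      then show ?thesis by simp
    qed (use ab e in auto)
  qed (auto simp: C_def)
  have "inj_on (\<lambda>(w, s). {w, s}) (SIGMA w:V - S. {s \<in> S. {w, s} \<in> E})"
    by (auto simp: inj_on_def doubleton_eq_iff)
  then have "card C = card (SIGMA w:V - S. {s \<in> S. {w, s} \<in> E})"
    unfolding C_def by (rule card_image)
  also have "\<dots> = (\<Sum>w\<in>V - S. card {s \<in> S. {w, s} \<in> E})"
    using fV finite_subset[OF S fV] by (intro card_SigmaI) auto
  finally have cC: "card C = (\<Sum>w\<in>V - S. card {s \<in> S. {w, s} \<in> E})" .
  have fC: "finite C" using fE by (rule rev_finite_subset) (auto simp: C_def)
  have "{} \<notin> E" using g by (auto simp: simple_graph_def)
  moreover have "e = {}" if "e \<subseteq> S" "e \<subseteq> V - S" for e using that by blast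
  ultimately have d1: "{e \<in> E. e \<subseteq> S} \<inter> {e \<in> E. e \<subseteq> V - S} = {}" by blast
  have d2: "({e \<in> E. e \<subseteq> S} \<union> {e \<in> E. e \<subseteq> V - S}) \<inter> C = {}"
    by (auto simp: C_def)
  have "card E = card ({e \<in> E. e \<subseteq> S} \<union> {e \<in> E. e \<subseteq> V - S} \<union> C)" using E by simp
  also have "\<dots> = card ({e \<in> E. e \<subseteq> S} \<union> {e \<in> E. e \<subseteq> V - S}) + card C"
    using fE fC d2 by (intro card_Un_disjoint) auto
  also have "card ({e \<in> E. e \<subseteq> S} \<union> {e \<in> E. e \<subseteq> V - S})
      = card {e \<in> E. e \<subseteq> S} + card {e \<in> E. e \<subseteq> V - S}"
    using fE d1 by (intro card_Un_disjoint) auto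
  finally show ?thesis using cC by simp
qed

lemma card_inner_edges:
  assumes g: "simple_graph V E" and Q: "Q \<subseteq> V"
  shows "card {e \<in> E. e \<subseteq> Q} + card {e. e \<subseteq> Q \<and> card e = 2 \<and> e \<notin> E} = card Q choose 2"
proof -
  have fQ: "finite Q" using g Q by (auto simp: simple_graph_def intro: finite_subset)
  let ?A = "{e \<in> E. e \<subseteq> Q}" and ?B = "{e. e \<subseteq> Q \<and> card e = 2 \<and> e \<notin> E}"
  have "?A \<union> ?B = {e. e \<subseteq> Q \<and> card e = 2}" using g by (auto simp: simple_graph_def)
  moreover have "card (?A \<union> ?B) = card ?A + card ?B"
    using fQ by (intro card_Un_disjoint) (auto intro: finite_subset[of _ "Pow Q"])
  ultimately show ?thesis using n_subsets[OF fQ] by simp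
qed

lemma choose_2_Suc: "Suc k choose 2 = k + (k choose 2)"
  by (simp add: numeral_2_eq_2)

section \<open>Independent optimal sets\<close>

text \<open>The case of an independent optimal set \<open>S\<close> whose two overdominated vertices \<open>x\<close> and \<open>y\<close>
  lie outside \<open>S\<close>.  The hypotheses are symmetric in \<open>x\<close> and \<open>y\<close>, so every lemma also holds with the
  roles of \<open>x\<close> and \<open>y\<close> exchanged.  \<open>X\<close> and \<open>Y\<close> below are their neighbourhoods in \<open>S\<close>.\<close>

locale independent_optimum =
  fixes V :: "'a set" and E :: "'a set set" and S :: "'a set" and x y :: 'a
  assumes graph: "simple_graph V E"
    and S_sub: "S \<subseteq> V"
    and indep: "\<And>s t. s \<in> S \<Longrightarrow> t \<in> S \<Longrightarrow> {s, t} \<notin> E"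
    and x: "x \<in> V" "x \<notin> S" and y: "y \<in> V" "y \<notin> S" and xy: "x \<noteq> y"
    and single_nbr: "\<And>v. v \<in> V - S \<Longrightarrow> v \<noteq> x \<Longrightarrow> v \<noteq> y \<Longrightarrow> \<exists>!s. s \<in> S \<and> {v, s} \<in> E"
    and X2: "2 \<le> card {s \<in> S. {x, s} \<in> E}" and Y2: "2 \<le> card {s \<in> S. {y, s} \<in> E}"
    and minimal: "\<And>T. dominating V E T \<Longrightarrow> CR_set V E T \<le> 2 \<Longrightarrow> card S \<le> card T"
begin

lemma swap: "independent_optimum V E S y x"
  using graph S_sub indep x y xy single_nbr X2 Y2 minimal
  by unfold_locales auto

abbreviation X where "X \<equiv> {s \<in> S. {x, s} \<in> E}"
abbreviation Y where "Y \<equiv> {s \<in> S. {y, s} \<in> E}"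

lemma fin: "finite V" "finite S"
  using graph S_sub finite_subset by (auto simp: simple_graph_def)

lemma card_S: "2 \<le> card S"
  using X2 card_mono[of S X] fin by simp

lemma card_X_le: "card X \<le> card S"
  using fin by (intro card_mono) auto

lemma X_eq_S:
  assumes "card X = card S" "s \<in> S"
  shows "{x, s} \<in> E"
proof -
  from assms have "X = S" using fin by (intro card_subset_eq) auto
  then show "{x, s} \<in> E" using \<open>s \<in> S\<close> by auto
qed

text \<open>The form in which minimality is used: a set that dominates all vertices, and dominates
  all but \<open>a\<close> and \<open>b\<close> only once, is not smaller than \<open>S\<close>.\<close>

lemma minimalI:
  assumes T: "T \<subseteq> V" and dom: "\<And>v. v \<in> V \<Longrightarrow> v \<in> T \<or> (\<exists>s\<in>T. {v, s} \<in> E)"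
    and over: "\<And>v s t. v \<in> V \<Longrightarrow> v \<noteq> a \<Longrightarrow> v \<noteq> b \<Longrightarrow> s \<in> T \<Longrightarrow> t \<in> T \<Longrightarrow>
      s = v \<or> {v, s} \<in> E \<Longrightarrow> t = v \<or> {v, t} \<in> E \<Longrightarrow> s = t"
  shows "card S \<le> card T"
proof (rule minimal)
  show "dominating V E T"
    unfolding dominating_iff[OF graph] using T dom by (metis insert_commute)
  have "{u. overdominated V E T u} \<subseteq> {a, b}"
    using over unfolding overdominated_iff[OF graph T] by blast
  then have "CR_set V E T \<le> card {a, b}"
    unfolding CR_set_def by (intro card_mono) auto
  also have "\<dots> \<le> 2" by (simp add: card_insert_if)
  finally show "CR_set V E T \<le> 2" .
qed

lemma not_universal:
  obtains v where "v \<in> V" "v \<noteq> x" "{x, v} \<notin> E"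
proof (rule ccontr)
  assume "\<not> thesis"
  then have "\<And>v. v \<in> V \<Longrightarrow> v \<noteq> x \<Longrightarrow> {v, x} \<in> E" using that by (metis insert_commute)
  then have "card S \<le> card {x}" using x by (intro minimalI) auto
  then show False using card_S by simp
qed

lemma card_edges:
  "card E = card {e \<in> E. e \<subseteq> V - S} + (card (V - S) - 2) + card X + card Y"
proof -
  have "{e \<in> E. e \<subseteq> S} = {}"
  proof (rule ccontr)
    assume "{e \<in> E. e \<subseteq> S} \<noteq> {}"
    then obtain e where e: "e \<in> E" "e \<subseteq> S" by auto
    obtain a b where "e = {a, b}" using edge_cases[OF graph e(1)] .
    with e indep show False by auto
  qed
  then have "card {e \<in> E. e \<subseteq> S} = 0" by (simp only: card.empty)
  moreover have "(\<Sum>w\<in>V - S. card {s \<in> S. {w, s} \<in> E})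
      = (\<Sum>w\<in>V - S - {x} - {y}. card {s \<in> S. {w, s} \<in> E}) + card X + card Y"
    using fin x y xy
    by (simp add: sum.remove[of "V - S" x] sum.remove[of "V - S - {x}" y])
  moreover have "(\<Sum>w\<in>V - S - {x} - {y}. card {s \<in> S. {w, s} \<in> E})
      = (\<Sum>w\<in>V - S - {x} - {y}. 1)"
  proof (rule sum.cong)
    fix w assume "w \<in> V - S - {x} - {y}"
    then obtain s where "{s \<in> S. {w, s} \<in> E} = {s}" using single_nbr[of w] by auto
    then show "card {s \<in> S. {w, s} \<in> E} = 1" by simp
  qed simp
  moreover have "card (V - S - {x} - {y}) = card (V - S) - 2"
    using fin x y xy by (simp add: card_Diff_singleton_if)
  ultimately show ?thesis using card_edges_split[OF graph S_sub] by simp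
qed

text \<open>\<open>D\<close> consists of the pairs missing outside \<open>S\<close>; the other two summands count the edges
  missing between \<open>S\<close> and \<open>x\<close>, and between \<open>S\<close> and \<open>y\<close>.  Each of \<open>x\<close> and \<open>y\<close> is incident with a missing
  edge, and one edge serves both only if it is \<open>xy\<close>.\<close>

lemma missing_edges:
  defines "D \<equiv> {e. e \<subseteq> V - S \<and> card e = 2 \<and> e \<notin> E}"
  shows "1 \<le> card D + (card S - card X) + (card S - card Y)"
    and "card D + (card S - card X) + (card S - card Y) = 1
      \<Longrightarrow> D = {{x, y}} \<and> card X = card S \<and> card Y = card S"
proof -
  interpret sw: independent_optimum V E S y x by (rule swap)
  have fD: "finite D" unfolding D_def
    by (rule finite_subset[of _ "Pow V"]) (use fin in auto)
  obtain v where v: "v \<in> V" "v \<noteq> x" "{x, v} \<notin> E" using not_universal .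
  obtain w where w: "w \<in> V" "w \<noteq> y" "{y, w} \<notin> E" using sw.not_universal .
  have xv: "{x, v} \<in> D \<or> card X < card S"
    using v x X_eq_S[of v] card_X_le unfolding D_def by (cases "v \<in> S") (auto simp: card_2_iff nat_less_le)
  have yw: "{y, w} \<in> D \<or> card Y < card S"
    using w y sw.X_eq_S[of w] sw.card_X_le unfolding D_def by (cases "w \<in> S") (auto simp: card_2_iff nat_less_le)
  have D0: "card D \<noteq> 0" if "e \<in> D" for e using that fD by auto
  show "1 \<le> card D + (card S - card X) + (card S - card Y)"
    using xv D0 by fastforce
  assume one: "card D + (card S - card X) + (card S - card Y) = 1"
  have "card D \<noteq> 0" using one xv yw D0 by fastforce
  then have 1: "card D = 1" "card X = card S" "card Y = card S"
    using one card_X_le sw.card_X_le by linarith+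
  then have "{x, v} \<in> D" "{y, w} \<in> D" using xv yw by auto
  then have "D = {{x, v}}" "{x, v} = {y, w}" using 1 by (auto simp: card_1_singleton_iff)
  then have "D = {{x, y}}" using xy by (auto simp: doubleton_eq_iff)
  with 1 show "D = {{x, y}} \<and> card X = card S \<and> card Y = card S" by simp
qed

lemma card_edges_missing:
  "card E + (card {e. e \<subseteq> V - S \<and> card e = 2 \<and> e \<notin> E}
      + (card S - card X) + (card S - card Y))
    = (card (V - S) choose 2) + (card (V - S) - 2) + 2 * card S"
proof -
  interpret sw: independent_optimum V E S y x by (rule swap)
  show ?thesis
    using card_edges card_inner_edges[OF graph, of "V - S"] card_X_le sw.card_X_le by auto
qed

text \<open>If only \<open>xy\<close> is missing, every element of \<open>S\<close> has a neighbour outside \<open>S\<close> other than \<open>x\<close> and \<open>y\<close>;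
  as no such vertex serves two elements of \<open>S\<close>, the bound on \<open>card S\<close> follows.\<close>

lemma missing_one_private:
  assumes D: "{e. e \<subseteq> V - S \<and> card e = 2 \<and> e \<notin> E} = {{x, y}}"
    and XY: "card X = card S" "card Y = card S" and r: "3 \<le> card S"
  shows "card S \<le> card (V - S) - 2"
proof (rule ccontr)
  interpret sw: independent_optimum V E S y x by (rule swap)
  assume less: "\<not> ?thesis"
  let ?P = "V - S - {x} - {y}"
  define f where "f v = (THE s. s \<in> S \<and> {v, s} \<in> E)" for v
  have f: "s = f v" if "v \<in> ?P" "s \<in> S" "{v, s} \<in> E" for v s
    using single_nbr[of v] that unfolding f_def by (metis (no_types, lifting) DiffE insertI1 theI)
  have "card (f ` ?P) \<le> card ?P" using fin by (intro card_image_le) auto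
  also have "\<dots> = card (V - S) - 2" using fin x y xy by (simp add: card_Diff_singleton_if)
  finally have "\<not> S \<subseteq> f ` ?P" 
    using less card_mono[OF finite_imageI[of ?P f], of S] fin by (meson finite_Diff le_trans)
  then obtain s where s: "s \<in> S" "s \<notin> f ` ?P" by auto
  have xE: "{v, x} \<in> E" if "v \<in> V" "v \<noteq> x" "v \<noteq> y" for v
  proof (cases "v \<in> S")
    case True
    then show ?thesis using X_eq_S[OF XY(1)] by (simp add: insert_commute)
  next
    case False
    then have "{v, x} \<notin> {e. e \<subseteq> V - S \<and> card e = 2 \<and> e \<notin> E}"
      unfolding D using that by (auto simp: doubleton_eq_iff)
    then show ?thesis using False that x by (auto simp: card_2_iff)
  qed
  have "{x, y} \<in> {{x, y}}" by simp
  then have xyE: "{x, y} \<notin> E" using D by blast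
  have ys: "{y, s} \<in> E" using sw.X_eq_S[OF XY(2) s(1)] .
  \<comment> \<open>Every vertex other than \<open>x\<close> and \<open>y\<close> is adjacent to \<open>x\<close>, and \<open>s\<close> is adjacent only to \<open>x\<close> and \<open>y\<close>;
    so only \<open>x\<close> and \<open>s\<close> are overdominated.\<close>
  have "card S \<le> card {x, s}"
  proof (rule minimalI[of _ x s])
    show "{x, s} \<subseteq> V" using x s S_sub by auto
    show "v \<in> {x, s} \<or> (\<exists>s\<in>{x, s}. {v, s} \<in> E)" if "v \<in> V" for v
      using xE[OF that] ys by blast
    fix v a b assume v: "v \<in> V" "v \<noteq> x" "v \<noteq> s" and "a \<in> {x, s}" "b \<in> {x, s}"
      "a = v \<or> {v, a} \<in> E" "b = v \<or> {v, b} \<in> E"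
    moreover have "\<not> ({v, x} \<in> E \<and> {v, s} \<in> E)"
    proof
      assume both: "{v, x} \<in> E \<and> {v, s} \<in> E"
      then have "v \<noteq> y" "v \<notin> S" using xyE s indep by (auto simp: insert_commute)
      then have "v \<in> ?P" using v by auto
      then show False using f[of v s] s both by blast
    qed
    ultimately show "a = b" by auto
  qed
  then show False using r by (simp add: card_insert_if split: if_splits)
qed

text \<open>Replacing \<open>X\<close> by \<open>x\<close> in \<open>S\<close> leaves \<open>x\<close> and all vertices of \<open>S\<close> dominated exactly once.  If only two
  further vertices exist, the smaller set obtained overdominates at most these two, so it
  cannot be dominating.\<close>

lemma exchange_x:
  assumes dom: "\<And>v. v \<in> V - S \<Longrightarrow> v \<noteq> x \<Longrightarrow> {v, x} \<in> E \<or> (\<exists>s\<in>S. s \<notin> X \<and> {v, s} \<in> E)"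
    and few: "V - S \<subseteq> {x, y, p}"
  shows False
proof -
  have "card S \<le> card (insert x (S - X))"
  proof (rule minimalI[of _ y p])
    show "insert x (S - X) \<subseteq> V" using x S_sub by auto
    show "v \<in> insert x (S - X) \<or> (\<exists>s\<in>insert x (S - X). {v, s} \<in> E)" if "v \<in> V" for v
      using dom[of v] that by (auto simp: insert_commute)
    fix v s t assume "v \<in> V" "v \<noteq> y" "v \<noteq> p" "s \<in> insert x (S - X)" "t \<in> insert x (S - X)"
      "s = v \<or> {v, s} \<in> E" "t = v \<or> {v, t} \<in> E"
    then show "s = t" using few indep x by (auto simp: insert_commute)
  qed
  also have "\<dots> = Suc (card S - card X)" using fin x by (simp add: card_Diff_subset)
  finally show False using X2 card_X_le by linarith
qed

text \<open>Replacing \<open>X\<close> by \<open>x\<close> and one more vertex \<open>z\<close> makes the set smaller as soon as \<open>X\<close> has three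
  elements.\<close>

lemma exchange_x_with:
  assumes z: "z \<in> V" "z \<noteq> x" "z \<in> X \<or> z \<notin> S"
    and dom: "\<And>v. v \<in> V - S \<Longrightarrow> v \<noteq> x \<Longrightarrow> v \<noteq> z \<Longrightarrow>
       {v, x} \<in> E \<or> {v, z} \<in> E \<or> (\<exists>s\<in>S. s \<notin> X \<and> {v, s} \<in> E)"
    and over: "\<And>v s t. v \<in> V \<Longrightarrow> v \<noteq> a \<Longrightarrow> v \<noteq> b \<Longrightarrow>
      s \<in> insert x (insert z (S - X)) \<Longrightarrow> t \<in> insert x (insert z (S - X)) \<Longrightarrow>
      s = v \<or> {v, s} \<in> E \<Longrightarrow> t = v \<or> {v, t} \<in> E \<Longrightarrow> s = t"
  shows "card X \<le> 2"
proof -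
  have "card S \<le> card (insert x (insert z (S - X)))"
  proof (rule minimalI[of _ a b])
    show "insert x (insert z (S - X)) \<subseteq> V" using x z S_sub by auto
    show "v \<in> insert x (insert z (S - X)) \<or> (\<exists>s\<in>insert x (insert z (S - X)). {v, s} \<in> E)"
      if "v \<in> V" for v
      using dom[of v] that by (auto simp: insert_commute)
  qed (rule over)
  also have "\<dots> = Suc (Suc (card S - card X))"
    using fin x z by (auto simp: card_Diff_subset card_insert_if)
  finally show ?thesis using card_X_le by linarith
qed


lemma two_outside:
  assumes Q: "V - S = {x, y}"
  shows "card E \<le> 4"
proof -
  interpret sw: independent_optimum V E S y x by (rule swap)
  have xyE: "{x, y} \<notin> E" and YX: "Y \<subseteq> X"
    using exchange_x[of y] Q by (auto simp: insert_commute)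
  have XY: "X \<subseteq> Y"
    using sw.exchange_x[of x] Q by (auto simp: insert_commute)
  have "X \<noteq> {}" using X2 by (metis card.empty not_numeral_le_zero)
  then obtain z where z: "z \<in> X" by auto
  have "card X \<le> 2"
  proof (rule exchange_x_with[of z x z])
    show "z \<in> V" "z \<noteq> x" using z S_sub x by auto
    fix v s t assume "v \<in> V" "v \<noteq> x" "v \<noteq> z"
      "s \<in> insert x (insert z (S - X))" "t \<in> insert x (insert z (S - X))"
      "s = v \<or> {v, s} \<in> E" "t = v \<or> {v, t} \<in> E"
    then show "s = t"
      using Q YX z xyE indep by (cases "v \<in> S") (auto simp: insert_commute)
  qed (use Q XY z in \<open>auto simp: insert_commute\<close>)
  moreover have "card Y = card X" by (rule arg_cong[OF subset_antisym[OF YX XY]])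
  moreover have "{e \<in> E. e \<subseteq> V - S} = {}"
  proof (rule ccontr)
    assume "{e \<in> E. e \<subseteq> V - S} \<noteq> {}"
    then obtain e where e: "e \<in> E" "e \<subseteq> {x, y}" using Q by auto
    obtain a b where "e = {a, b}" "a \<noteq> b" using edge_cases[OF graph e(1)] .
    with e xyE show False by (auto simp: insert_commute)
  qed
  then have "card {e \<in> E. e \<subseteq> V - S} = 0" by (simp only: card.empty)
  moreover have "card (V - S) = 2" using Q xy by simp
  ultimately show ?thesis using card_edges by simp
qed

end

section \<open>Three vertices outside the optimal set\<close>

text \<open>The vertices outside \<open>S\<close> are \<open>x\<close>, \<open>y\<close> and one further vertex \<open>p\<close>, whose only neighbour in \<open>S\<close> is
  \<open>q\<close>.\<close>

locale three_outside = independent_optimum +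
  fixes p q
  assumes Q: "V - S = {x, y, p}" and p: "p \<noteq> x" "p \<noteq> y"
    and q: "q \<in> S" "{p, q} \<in> E" and q_only: "\<And>s. s \<in> S \<Longrightarrow> {p, s} \<in> E \<Longrightarrow> s = q"
begin

lemma swap_xy: "three_outside V E S y x p q"
proof (intro three_outside.intro three_outside_axioms.intro)
  show "V - S = {y, x, p}" using Q by blast
qed (fact swap p q q_only)+

lemma p_out: "p \<in> V" "p \<notin> S" using Q by auto

text \<open>Replacing \<open>X\<close> by \<open>x\<close> leaves \<open>y\<close> or \<open>p\<close> undominated.\<close>

lemma exchange_dichotomy: "({x, y} \<notin> E \<and> Y \<subseteq> X) \<or> ({x, p} \<notin> E \<and> q \<in> X)"
proof (rule ccontr)
  assume neg: "\<not> ?thesis"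
  show False
  proof (rule exchange_x[of p])
    fix v assume "v \<in> V - S" "v \<noteq> x"
    then have "v = y \<or> v = p" using Q by auto
    then show "{v, x} \<in> E \<or> (\<exists>s\<in>S. s \<notin> X \<and> {v, s} \<in> E)"
      using neg q by (auto simp: insert_commute)
  qed (use Q in auto)
qed

text \<open>Here \<open>X\<close> is replaced by \<open>x\<close> and \<open>z\<close>.  Then \<open>y\<close> is dominated by \<open>z\<close> only, and the condition on \<open>p\<close>
  says that \<open>p\<close> is dominated exactly once: by \<open>x\<close> or by \<open>q\<close>.\<close>

lemma exchange_nbr:
  assumes "{x, y} \<notin> E" "Y \<subseteq> X" and z: "z \<in> Y"
    and once: "(if {x, p} \<in> E then z \<noteq> q \<and> q \<in> X else z = q \<or> q \<notin> X)"
  shows "card X \<le> 2"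
proof (rule exchange_x_with[of z x z])
  show "z \<in> V" "z \<noteq> x" using z S_sub x by auto
  show "z \<in> X \<or> z \<notin> S" using z assms(2) by auto
  fix v assume "v \<in> V - S" "v \<noteq> x" "v \<noteq> z"
  then have "v = y \<or> v = p" using Q by auto
  then show "{v, x} \<in> E \<or> {v, z} \<in> E \<or> (\<exists>s\<in>S. s \<notin> X \<and> {v, s} \<in> E)"
    using z q once by (auto simp: insert_commute split: if_splits)
next
  fix v s t assume v: "v \<in> V" "v \<noteq> x" "v \<noteq> z" and
    st: "s \<in> insert x (insert z (S - X))" "t \<in> insert x (insert z (S - X))"
    "s = v \<or> {v, s} \<in> E" "t = v \<or> {v, t} \<in> E"
  consider "v \<in> S" | "v = y" | "v = p" using v Q by auto
  then show "s = t"
  proof cases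
    case 1
    then show ?thesis using st v z x indep by (auto simp: insert_commute)
  next
    case 2
    then show ?thesis using st v z y xy assms(1,2) by (auto simp: insert_commute)
  next
    case 3
    have only: "u = (if {x, p} \<in> E then x else q)"
      if u: "u \<in> insert x (insert z (S - X))" "u = v \<or> {v, u} \<in> E" for u
    proof -
      have "u \<noteq> p" using u z p p_out by auto
      then have pu: "{p, u} \<in> E" using u 3 by simp
      have "u = x \<or> u \<in> S" using u z by auto
      then have "u = x \<or> u = q" using pu q_only by blast
      moreover have "{x, p} \<in> E" if "u = x" using pu that by (simp add: insert_commute)
      moreover have "u = z \<or> q \<notin> X" if "u = q" using u x q that by blast
      ultimately show ?thesis using once by (metis)
    qed
    show ?thesis using only[OF st(1,3)] only[OF st(2,4)] by (rule trans[OF _ sym])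
  qed
qed

text \<open>Here \<open>X\<close> is replaced by \<open>x\<close> and \<open>p\<close>, which overdominates at most \<open>q\<close> and \<open>y\<close>.\<close>

lemma exchange_p:
  assumes "{x, p} \<notin> E" "q \<in> X" "{x, y} \<in> E \<or> \<not> Y \<subseteq> X"
  shows "card X \<le> 2"
proof (rule exchange_x_with[of p q y])
  fix v assume "v \<in> V - S" "v \<noteq> x" "v \<noteq> p"
  then have "v = y" using Q by auto
  then show "{v, x} \<in> E \<or> {v, p} \<in> E \<or> (\<exists>s\<in>S. s \<notin> X \<and> {v, s} \<in> E)"
    using assms by (auto simp: insert_commute)
next
  fix v s t assume v: "v \<in> V" "v \<noteq> q" "v \<noteq> y" and
    st: "s \<in> insert x (insert p (S - X))" "t \<in> insert x (insert p (S - X))"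
    "s = v \<or> {v, s} \<in> E" "t = v \<or> {v, t} \<in> E"
  consider "v \<in> S" | "v = x" | "v = p" using v Q by auto
  then show "s = t"
  proof cases
    case 1
    then show ?thesis using st v x p_out indep q_only by (auto simp: insert_commute)
  next
    case 2
    then show ?thesis using st assms by (auto simp: insert_commute)
  next
    case 3
    then show ?thesis using st assms q_only by (auto simp: insert_commute)
  qed
qed (use p p_out in auto)

text \<open>If \<open>p\<close> were a common neighbour of \<open>x\<close> and \<open>y\<close>, then \<open>X \<union> {q}\<close> could be replaced by \<open>x\<close> and \<open>p\<close>,
  which overdominates only \<open>x\<close> and \<open>p\<close>.\<close>

lemma p_not_common:
  assumes "{x, y} \<notin> E" "X = Y" "q \<notin> X"
  shows "{x, p} \<notin> E \<or> {y, p} \<notin> E"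
proof (rule ccontr)
  assume "\<not> ?thesis"
  then have xp: "{x, p} \<in> E" and yp: "{y, p} \<in> E" by auto
  have "card S \<le> card (insert x (insert p (S - X - {q})))"
  proof (rule minimalI[of _ x p])
    show "insert x (insert p (S - X - {q})) \<subseteq> V" using x p_out S_sub by auto
    show "v \<in> insert x (insert p (S - X - {q})) \<or>
        (\<exists>s\<in>insert x (insert p (S - X - {q})). {v, s} \<in> E)" if "v \<in> V" for v
      using Q that yp q by (cases "v \<in> S") (auto simp: insert_commute)
  next
    fix v s t assume v: "v \<in> V" "v \<noteq> x" "v \<noteq> p" and
      st: "s \<in> insert x (insert p (S - X - {q}))" "t \<in> insert x (insert p (S - X - {q}))"
      "s = v \<or> {v, s} \<in> E" "t = v \<or> {v, t} \<in> E"
    consider "v \<in> S" | "v = y" using v Q by auto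
    then show "s = t"
    proof cases
      case 1
      then show ?thesis using st x p_out indep q_only assms by (auto simp: insert_commute)
    next
      case 2
      then show ?thesis using st y xy assms by (auto simp: insert_commute)
    qed
  qed
  also have "\<dots> = Suc (Suc (card (S - X - {q})))"
    using fin x p p_out by (auto simp: card_insert_if)
  also have "card (S - X - {q}) = card S - card X - 1"
    using fin q assms by (subst card_Diff_singleton) (auto simp: card_Diff_subset)
  finally have "card S \<le> Suc (Suc (card S - card X - 1))" .
  moreover have "card X < card S"
    using fin q assms(3) by (intro psubset_card_mono) auto
  ultimately show False using X2 by linarith
qed

text \<open>The vertex \<open>z\<close> of lemma \<open>exchange_nbr\<close> is taken different from \<open>q\<close> if \<open>p\<close> is adjacent to \<open>x\<close>, and
  equal to \<open>q\<close> (when \<open>q \<in> Y\<close>) if it is not.\<close>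

lemma card_X_le_2:
  assumes "{x, y} \<notin> E" "Y \<subseteq> X" "q \<in> Y \<or> q \<notin> X \<and> {x, p} \<notin> E"
  shows "card X \<le> 2"
proof (cases "{x, p} \<in> E")
  case True
  then have qY: "q \<in> Y" using assms by auto
  have "\<exists>z\<in>Y. z \<noteq> q"
  proof -
    have "finite Y" using fin by simp
    then have "\<exists>s\<in>Y. \<exists>t\<in>Y. s \<noteq> t" using Y2 card_ge_2_iff by blast
    then show ?thesis by metis
  qed
  then obtain z where "z \<in> Y" "z \<noteq> q" by auto
  then show ?thesis using assms qY True by (intro exchange_nbr[of z]) auto
next
  case False
  have "Y \<noteq> {}" using Y2 by (metis card.empty not_numeral_le_zero)
  then obtain z where "z \<in> Y" by auto
  then show ?thesis
    using assms False exchange_nbr[of q] exchange_nbr[of z] by (cases "q \<in> Y") auto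
qed

lemma card_edges_le_7: "card E \<le> 7"
proof -
  interpret sw: three_outside V E S y x p q by (rule swap_xy)
  have yx: "{y, x} = {x, y}" by auto
  have "card X \<le> 2 \<and> card Y \<le> 2 \<and> ({x, y} \<notin> E \<or> {x, p} \<notin> E \<and> {y, p} \<notin> E)"
  proof -
    consider (a) "{x, y} \<notin> E" "X = Y" | (b) "{x, y} \<notin> E" "Y \<subseteq> X" "q \<in> Y"
      | (c) "{x, y} \<notin> E" "X \<subseteq> Y" "q \<in> X"
      | (d) "{x, p} \<notin> E" "{y, p} \<notin> E" "q \<in> X" "q \<in> Y"
      using exchange_dichotomy sw.exchange_dichotomy unfolding yx by blast
    then show ?thesis
    proof cases
      case a
      then have "card X \<le> 2 \<or> card Y \<le> 2"
        using card_X_le_2 sw.card_X_le_2 p_not_common unfolding yx by blast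
      moreover have "card X = card Y" by (rule arg_cong[OF a(2)])
      ultimately show ?thesis using a(1) by linarith
    next
      case b
      then have "card X \<le> 2" "card Y \<le> card X"
        using card_X_le_2 fin by (auto intro: card_mono)
      then show ?thesis using b by simp
    next
      case c
      then have "card Y \<le> 2" "card X \<le> card Y"
        using sw.card_X_le_2 fin unfolding yx by (auto intro: card_mono)
      then show ?thesis using c by simp
    next
      case d
      have "card X \<le> 2" using card_X_le_2 exchange_p d by blast
      moreover have "card Y \<le> 2" using sw.card_X_le_2 sw.exchange_p d unfolding yx by blast
      ultimately show ?thesis using d by simp
    qed
  qed
  moreover have "card {e \<in> E. e \<subseteq> V - S} \<le> 2"
    if out: "{x, y} \<notin> E \<or> {x, p} \<notin> E \<and> {y, p} \<notin> E"
  proof -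
    have "{e \<in> E. e \<subseteq> V - S} \<subseteq> {{x, y}, {x, p}, {y, p}} \<inter> E"
    proof
      fix e assume "e \<in> {e \<in> E. e \<subseteq> V - S}"
      then have e: "e \<in> E" "e \<subseteq> {x, y, p}" using Q by auto
      obtain a b where "e = {a, b}" "a \<noteq> b" using edge_cases[OF graph e(1)] .
      with e show "e \<in> {{x, y}, {x, p}, {y, p}} \<inter> E" by (auto simp: insert_commute)
    qed
    also have "\<dots> \<subseteq> (if {x, y} \<in> E then {{x, y}} else {{x, p}, {y, p}})"
      using out by auto
    finally have "card {e \<in> E. e \<subseteq> V - S}
        \<le> card (if {x, y} \<in> E then {{x, y}} else {{x, p}, {y, p}})"
      by (rule card_mono[rotated]) auto
    also have "\<dots> \<le> 2" by (simp add: card_insert_if)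
    finally show ?thesis .
  qed
  moreover have "card (V - S) = 3" using Q p xy by (simp add: card_insert_if)
  ultimately show ?thesis using card_edges by simp
qed

end

section \<open>Upper bounds\<close>

lemma card_edges_cases:
  assumes g: "simple_graph V E" and CR: "CR V E = 2" "gamma_CR V E = r"
  obtains (edge) "card E \<le> 1 + (card V - r + 1 choose 2)" "r \<le> card V"
  | (outside) S x y where "independent_optimum V E S x y" "card S = r"
proof -
  obtain S where S: "dominating V E S" "CR_set V E S = 2" "card S = r"
    "\<And>T. dominating V E T \<Longrightarrow> CR_set V E T \<le> 2 \<Longrightarrow> card S \<le> card T"
    using CR_gamma_witness[OF g] CR by metis
  have SV: "S \<subseteq> V" using S(1) by (simp add: dominating_def)
  have fin: "finite V" "finite S"
    using g SV finite_subset by (auto simp: simple_graph_def)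
  have rV: "r \<le> card V" using S(3) SV fin card_mono by auto
  obtain x y where O: "{u. overdominated V E S u} = {x, y}" "x \<noteq> y"
    using S(2) unfolding CR_set_def by (auto simp: card_2_iff)
  have ov: "overdominated V E S u \<longleftrightarrow> u = x \<or> u = y" for u using O by auto
  have xy: "x \<in> V" "y \<in> V" using ov unfolding overdominated_iff[OF g SV] by blast+
  have once: "\<exists>!s. s \<in> S \<and> {v, s} \<in> E" if v: "v \<in> V - S" "v \<noteq> x" "v \<noteq> y" for v
    using not_overdominated_unique[OF g SV _ S(1), of v] v ov by blast
  \<comment> \<open>An edge inside \<open>S\<close> overdominates both its ends.\<close>
  have in_S: "overdominated V E S s \<and> overdominated V E S t"
    if "s \<in> S" "t \<in> S" "{s, t} \<in> E" for s t
    unfolding overdominated_iff[OF g SV]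
    using that edgeD[OF g that(3)] by (metis insert_commute)
  show thesis
  proof (cases "\<exists>s\<in>S. \<exists>t\<in>S. {s, t} \<in> E")
    case True
    then obtain s t where st: "s \<in> S" "t \<in> S" "{s, t} \<in> E" by auto
    then have "s \<noteq> t" using edgeD[OF g] by blast
    then have eq: "{s, t} = {x, y}" using in_S[OF st] ov by auto
    have xyS: "x \<in> S" "y \<in> S" using st(1,2) eq by auto
    have "{e \<in> E. e \<subseteq> S} \<subseteq> {{x, y}}"
    proof
      fix e assume "e \<in> {e \<in> E. e \<subseteq> S}"
      then have e: "e \<in> E" "e \<subseteq> S" by auto
      obtain a b where "e = {a, b}" "a \<noteq> b" using edge_cases[OF g e(1)] .
      with e in_S[of a b] ov show "e \<in> {{x, y}}" by auto
    qed
    then have 1: "card {e \<in> E. e \<subseteq> S} \<le> 1"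
      by (metis card_1_singleton_iff card_mono finite.emptyI finite_insert One_nat_def)
    have "(\<Sum>w\<in>V - S. card {s \<in> S. {w, s} \<in> E}) = (\<Sum>w\<in>V - S. 1)"
    proof (rule sum.cong)
      fix w assume w: "w \<in> V - S"
      then have "w \<noteq> x" "w \<noteq> y" using xyS by auto
      then obtain s where "{s \<in> S. {w, s} \<in> E} = {s}" using once[OF w] by auto
      then show "card {s \<in> S. {w, s} \<in> E} = 1" by simp
    qed simp
    moreover have "card (V - S) = card V - r" using fin SV S(3) by (simp add: card_Diff_subset)
    ultimately have "card E \<le> 1 + (card V - r + 1 choose 2)"
      using 1 card_edges_split[OF g SV] card_inner_edges[OF g, of "V - S"]
      by (simp add: choose_2_Suc)
    then show thesis using edge rV by simp
  next
    case False
    have two: "u \<notin> S \<and> 2 \<le> card {s \<in> S. {u, s} \<in> E}" if "overdominated V E S u" for u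
    proof -
      from that False obtain s t where "s \<in> S" "t \<in> S" "s \<noteq> t" "{u, s} \<in> E" "{u, t} \<in> E" "u \<notin> S"
        unfolding overdominated_iff[OF g SV] by blast
      then show ?thesis using fin by (subst card_ge_2_iff) auto
    qed
    have "independent_optimum V E S x y"
      by unfold_locales (use g SV False xy O ov two once S(4) in blast)+
    then show thesis using outside S(3) by blast
  qed
qed

lemma three_elements:
  assumes "card A = 3" "x \<in> A" "y \<in> A" "x \<noteq> y"
  obtains p where "A = {x, y, p}" "p \<noteq> x" "p \<noteq> y"
proof -
  have fA: "finite A" using assms(1) by (metis card.infinite zero_neq_numeral)
  then have "card (A - {x} - {y}) = 1" using assms by (simp add: card_Diff_singleton_if)
  then obtain p where "A - {x} - {y} = {p}" by (auto simp: card_1_singleton_iff)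
  then show thesis using that assms by blast
qed

theorem upper_bounds:
  assumes "e \<in> graph_sizes n 2 r"
  shows "r = 2 \<Longrightarrow> n \<ge> 3 \<Longrightarrow> e \<le> ((n - 1) choose 2) + 1"
    and "3 \<le> r \<Longrightarrow> e \<le> 2 * (r - 2) + ((n - r + 1) choose 2) + 1"
    and "3 \<le> r \<Longrightarrow> n - r - 2 < r \<Longrightarrow> e \<le> 2 * (r - 2) + ((n - r + 1) choose 2)"
    and "r + 3 = n \<Longrightarrow> e \<le> 7"
    and "r + 2 = n \<Longrightarrow> e \<le> 4"
proof -
  obtain V :: "nat set" and E where g: "simple_graph V E" and V: "card V = n"
    and CR: "CR V E = 2" "gamma_CR V E = r" and e: "e = card E"
    using assms by (auto simp: graph_sizes_def)
  have "(r = 2 \<and> n \<ge> 3 \<longrightarrow> e \<le> ((n - 1) choose 2) + 1) \<and>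
    (3 \<le> r \<longrightarrow> e \<le> 2 * (r - 2) + ((n - r + 1) choose 2) + 1) \<and>
    (3 \<le> r \<and> n - r - 2 < r \<longrightarrow> e \<le> 2 * (r - 2) + ((n - r + 1) choose 2)) \<and>
    (r + 3 = n \<longrightarrow> e \<le> 7) \<and> (r + 2 = n \<longrightarrow> e \<le> 4)"
    using g CR
  proof (cases rule: card_edges_cases)
    case edge
    moreover have "n - 2 + 1 = n - 1" if "n \<ge> 3" using that by simp
    moreover have "Suc 3 choose 2 = (6::nat)" "Suc 2 choose 2 = (3::nat)"
      by (simp_all add: numeral_eq_Suc)
    moreover have "r + 3 = n \<Longrightarrow> n - r + 1 = Suc 3" "r + 2 = n \<Longrightarrow> n - r + 1 = Suc 2" by auto
    ultimately show ?thesis using V e by auto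
  next
    case (outside S x y)
    interpret independent_optimum V E S x y by (rule outside(1))
    have Q: "card (V - S) = n - r"
      using fin S_sub V outside(2) by (simp add: card_Diff_subset)
    have "card {x, y} \<le> card (V - S)" using fin x y by (intro card_mono) auto
    then have q2: "2 \<le> n - r" using xy Q by simp
    have r2: "2 \<le> r" using card_S outside(2) by simp
    \<comment> \<open>The number of edges missing from the maximum possible in this configuration.\<close>
    define d where "d = card {e. e \<subseteq> V - S \<and> card e = 2 \<and> e \<notin> E}
      + (card S - card X) + (card S - card Y)"
    have d1: "1 \<le> d" unfolding d_def by (rule missing_edges)
    have d2: "2 \<le> d" if "3 \<le> r" "n - r - 2 < r"
    proof (rule ccontr)
      assume "\<not> 2 \<le> d"
      then have "d = 1" using d1 by simp
      then show False
        using missing_edges(2) missing_one_private that Q outside(2) unfolding d_def by fastforce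
    qed
    have "e + d = (n - r choose 2) + (n - r - 2) + 2 * r"
      using card_edges_missing Q outside(2) e unfolding d_def by simp
    moreover have "n - r + 1 choose 2 = (n - r) + (n - r choose 2)" by (simp add: choose_2_Suc)
    ultimately have ed: "e + d = (n - r + 1 choose 2) + 2 * (r - 1)" using q2 r2 by linarith
    have "e \<le> 4" if "r + 2 = n"
    proof -
      have "{x, y} = V - S" using x y xy Q that fin by (intro card_subset_eq) auto
      then show ?thesis using two_outside e by simp
    qed
    moreover have "e \<le> 7" if "r + 3 = n"
    proof -
      have "card (V - S) = 3" "x \<in> V - S" "y \<in> V - S" using Q that x y by auto
      then obtain p where p: "V - S = {x, y, p}" "p \<noteq> x" "p \<noteq> y"
        using three_elements[OF _ _ _ xy] by metis
      obtain q where q: "q \<in> S" "{p, q} \<in> E" "\<And>s. s \<in> S \<Longrightarrow> {p, s} \<in> E \<Longrightarrow> s = q"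
        using single_nbr[of p] p by blast
      have "three_outside V E S x y p q"
        by (intro three_outside.intro three_outside_axioms.intro) (fact outside(1) p q)+
      then show ?thesis unfolding e by (rule three_outside.card_edges_le_7)
    qed
    moreover have "n - 2 + 1 = n - 1" if "n \<ge> 3" using that by simp
    ultimately show ?thesis using ed d1 d2 r2 by auto
  qed
  then show "r = 2 \<Longrightarrow> n \<ge> 3 \<Longrightarrow> e \<le> ((n - 1) choose 2) + 1"
    and "3 \<le> r \<Longrightarrow> e \<le> 2 * (r - 2) + ((n - r + 1) choose 2) + 1"
    and "3 \<le> r \<Longrightarrow> n - r - 2 < r \<Longrightarrow> e \<le> 2 * (r - 2) + ((n - r + 1) choose 2)"
    and "r + 3 = n \<Longrightarrow> e \<le> 7"
    and "r + 2 = n \<Longrightarrow> e \<le> 4" by auto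
qed

section \<open>A clique split between the ends of an edge\<close>

lemma closed_nbhd_commute:
  assumes "simple_graph V E"
  shows "v \<in> closed_nbhd V E u \<longleftrightarrow> u \<in> closed_nbhd V E v"
  by (auto simp: mem_closed_nbhd[OF assms] insert_commute)

text \<open>Two elements of a dominating set overdominate all their common closed neighbours.\<close>

lemma card_common_nbhd_le:
  assumes g: "simple_graph V E" and "dominating V E T" "a \<in> T" "b \<in> T" "a \<noteq> b"
    and "A \<subseteq> closed_nbhd V E a \<inter> closed_nbhd V E b"
  shows "card A \<le> CR_set V E T"
proof (rule CR_set_ge[OF g], rule)
  fix u assume "u \<in> A"
  then have ab: "a \<in> closed_nbhd V E u" "b \<in> closed_nbhd V E u" and ua: "u \<in> closed_nbhd V E a"
    using assms(6) closed_nbhd_commute[OF g] by blast+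
  have T: "T \<subseteq> V" using assms(2) by (simp add: dominating_def)
  then have "u \<in> V" using ua assms(3) by (auto simp: closed_nbhd_def)
  moreover have "a = u \<or> {u, a} \<in> E" "b = u \<or> {u, b} \<in> E"
    using ab by (simp_all add: mem_closed_nbhd[OF g])
  ultimately show "u \<in> {u. overdominated V E T u}"
    using assms(3-5) unfolding overdominated_iff[OF g T] by blast
qed

text \<open>On the vertices below \<open>m\<close>: the clique \<open>{2..<m}\<close> and the edge \<open>{0, 1}\<close>, with \<open>2\<close> joined to \<open>0\<close> and the
  other clique vertices joined to \<open>1\<close>.  It is written as the complement of the missing edges.
  Vertices from \<open>m\<close> on are isolated.\<close>

definition split_edges :: "nat \<Rightarrow> nat set set" where
  "split_edges m = {e. e \<subseteq> {..<m} \<and> card e = 2} - insert {1, 2} ((\<lambda>k. {0, k}) ` {3..<m})"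

lemma split_edges_iff:
  assumes "a < b"
  shows "{a, b} \<in> split_edges m \<longleftrightarrow> b < m \<and> \<not> (a = 1 \<and> b = 2) \<and> \<not> (a = 0 \<and> 3 \<le> b)"
  using assms by (auto simp: split_edges_def doubleton_eq_iff)

lemma split_edges_graph:
  assumes "m \<le> n"
  shows "simple_graph {..<n} (split_edges m)"
  using assms by (auto simp: split_edges_def simple_graph_def)

lemma card_split_edges:
  assumes "4 \<le> m"
  shows "card (split_edges m) = ((m - 1) choose 2) + 1"
proof -
  let ?F = "insert {1, 2} ((\<lambda>k. {0, k}) ` {3..<m})"
  have "card ((\<lambda>k. {0, k}) ` {3..<m}) = m - 3"
    by (subst card_image) (auto simp: inj_on_def doubleton_eq_iff)
  then have F: "card ?F = m - 2"
    using assms by (subst card_insert_disjoint) (auto simp: doubleton_eq_iff)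
  have "?F \<subseteq> {e. e \<subseteq> {..<m} \<and> card e = 2}" using assms by auto
  then have "card (split_edges m) = card {e. e \<subseteq> {..<m} \<and> card e = 2} - card ?F"
    unfolding split_edges_def by (intro card_Diff_subset) auto
  also have "\<dots> = (m choose 2) - (m - 2)" using F n_subsets[of "{..<m}" 2] by simp
  also have "m choose 2 = (m - 1) + ((m - 1) choose 2)"
    using choose_2_Suc[of "m - 1"] assms by simp
  finally show ?thesis using assms by simp
qed

lemma split_edges_common:
  assumes m: "4 \<le> m" "m \<le> n" and ab: "a < b" "b < m"
  shows "\<exists>A. card A = 2 \<and>
    A \<subseteq> closed_nbhd {..<n} (split_edges m) a \<inter> closed_nbhd {..<n} (split_edges m) b"
proof -
  note mem = mem_closed_nbhd[OF split_edges_graph[OF m(2)]]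
  have iff: "{u, v} \<in> split_edges m \<longleftrightarrow> (if u < v
      then v < m \<and> \<not> (u = 1 \<and> v = 2) \<and> \<not> (u = 0 \<and> 3 \<le> v)
      else v < u \<and> u < m \<and> \<not> (v = 1 \<and> u = 2) \<and> \<not> (v = 0 \<and> 3 \<le> u))" for u v
  proof (cases u v rule: linorder_cases)
    case equal
    then show ?thesis by (simp add: split_edges_def)
  qed (use split_edges_iff[of u v m] split_edges_iff[of v u m] in \<open>auto simp: insert_commute\<close>)
  consider "a = 0" "3 \<le> b" | "a = 1" "b = 2" | "\<not> (a = 0 \<and> 3 \<le> b)" "\<not> (a = 1 \<and> b = 2)"
    by blast
  then show ?thesis
  proof cases
    case 1
    then show ?thesis using m ab by (intro exI[of _ "{1, 2}"]) (auto simp: mem iff)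
  next
    case 2
    then show ?thesis using m ab by (intro exI[of _ "{0, 3}"]) (auto simp: mem iff)
  next
    case 3
    then show ?thesis using m ab by (intro exI[of _ "{a, b}"]) (auto simp: mem iff)
  qed
qed

text \<open>The vertices below \<open>m\<close> are dominated by \<open>0\<close> and \<open>1\<close>, which overdominate only each other.  No
  single vertex dominates them all, so every dominating set contains two of them, and these have
  at least two common closed neighbours.  Each isolated vertex belongs to every dominating set.\<close>

theorem split_edges_attains:
  assumes m: "4 \<le> m" "m \<le> n"
  shows "((m - 1) choose 2) + 1 \<in> graph_sizes n 2 (n - m + 2)"
proof -
  let ?V = "{..<n}" and ?E = "split_edges m" and ?S = "{0, 1} \<union> {m..<n}"
  note g = split_edges_graph[OF m(2)]
  note iff = split_edges_iff[where m = m]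
  have small: "a < m \<and> b < m \<and> a \<noteq> b" if "{a, b} \<in> ?E" for a b
    using that by (auto simp: split_edges_def card_insert_if split: if_splits)
  have SV: "?S \<subseteq> ?V" using m by auto
  have dom: "dominating ?V ?E ?S"
    unfolding dominating_iff[OF g]
  proof (intro conjI ballI SV)
    fix v assume "v \<in> ?V"
    moreover have "{0, 2} \<in> ?E" "3 \<le> v \<Longrightarrow> v < m \<Longrightarrow> {1, v} \<in> ?E"
      using iff[of 0 2] iff[of 1 v] m by auto
    moreover have "v = 0 \<or> v = 1 \<or> v = 2 \<or> 3 \<le> v" by auto
    ultimately show "v \<in> ?S \<or> (\<exists>s\<in>?S. {s, v} \<in> ?E)" by force
  qed
  have "{u. overdominated ?V ?E ?S u} \<subseteq> {0, 1}"
  proof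
    fix u assume "u \<in> {u. overdominated ?V ?E ?S u}"
    then obtain s t where st: "s \<in> ?S" "t \<in> ?S" "s \<noteq> t"
      "s = u \<or> {u, s} \<in> ?E" "t = u \<or> {u, t} \<in> ?E"
      unfolding mem_Collect_eq overdominated_iff[OF g SV] by blast
    have "s < m" "t < m" using st small[of u s] small[of u t] by auto
    then have "s \<le> 1" "t \<le> 1" using st by auto
    then have "0 = u \<or> {0, u} \<in> ?E" "1 = u \<or> {1, u} \<in> ?E"
      using st by (auto simp: insert_commute le_Suc_eq)
    then show "u \<in> {0, 1}" using iff[of 0 u] iff[of 1 u] by fastforce
  qed
  then have "CR_set ?V ?E ?S \<le> card {0, 1 :: nat}"
    unfolding CR_set_def by (intro card_mono) auto
  then have CS: "CR_set ?V ?E ?S \<le> 2" by simp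
  have lower: "2 \<le> CR_set ?V ?E T \<and> n - m + 2 \<le> card T" if T: "dominating ?V ?E T" for T
  proof -
    have TV: "T \<subseteq> ?V" and Td: "\<And>v. v < n \<Longrightarrow> v \<in> T \<or> (\<exists>s\<in>T. {s, v} \<in> ?E)"
      using T unfolding dominating_iff[OF g] by auto
    have fT: "finite T" using TV finite_subset by blast
    have iso: "{m..<n} \<subseteq> T" using Td small by fastforce
    have "\<exists>a\<in>T. \<exists>b\<in>T. a < b \<and> b < m"
    proof (rule ccontr)
      assume no: "\<not> ?thesis"
      have "\<exists>s\<in>T. s < m \<and> (s = v \<or> {s, v} \<in> ?E)" if "v < m" for v
        using Td[of v] small[of _ v] that m by force
      moreover have "s = t" if "s \<in> T" "t \<in> T" "s < m" "t < m" for s t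
        using no that by (meson linorder_neqE_nat)
      moreover have "0 < m" using m by simp
      ultimately obtain s where s: "s \<in> T" "s < m" "\<And>v. v < m \<Longrightarrow> s = v \<or> {s, v} \<in> ?E"
        by metis
      have "s = 0 \<or> s = 1 \<or> 2 = s \<or> 3 \<le> s" by auto
      moreover have "\<not> {2, 1} \<in> ?E" "\<not> {s, 0} \<in> ?E" if "3 \<le> s"
        using iff[of 1 2] iff[of 0 s] that by (simp_all add: insert_commute)
      ultimately show False
        using s(3)[of 0] s(3)[of 1] s(3)[of 2] s(3)[of 3] iff[of 0 3] iff[of 1 2] iff[of 0 s] m
        by (auto simp: insert_commute)
    qed
    then obtain a b where ab: "a \<in> T" "b \<in> T" "a < b" "b < m" by blast
    obtain A where "card A = 2" "A \<subseteq> closed_nbhd ?V ?E a \<inter> closed_nbhd ?V ?E b"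
      using split_edges_common[OF m ab(3,4)] by blast
    then have "2 \<le> CR_set ?V ?E T"
      using card_common_nbhd_le[OF g T ab(1,2), of A] ab(3) by simp
    moreover have "card ({a, b} \<union> {m..<n}) \<le> card T"
      using ab iso fT by (intro card_mono) auto
    moreover have "card ({a, b} \<union> {m..<n}) = n - m + 2"
      using ab by (subst card_Un_disjoint) auto
    ultimately show ?thesis by simp
  qed
  have cS: "card ?S = n - m + 2" using m by (subst card_Un_disjoint) auto
  have CS2: "CR_set ?V ?E ?S = 2" using CS lower[OF dom] by simp
  have min: "CR_set ?V ?E T = 2 \<and> n - m + 2 \<le> card T"
    if "dominating ?V ?E T" "CR_set ?V ?E T \<le> 2" for T
    using lower[OF that(1)] that(2) by simp
  have "CR ?V ?E = 2" "gamma_CR ?V ?E = n - m + 2"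
    by (rule CR_gamma_eqI[OF g dom CS2 cS min]; assumption)+
  then show ?thesis
    unfolding graph_sizes_def using g card_split_edges[OF m(1)] by (force intro: exI[of _ ?V])
qed

section \<open>Two hubs over a clique and an independent set\<close>

lemma pair_eq_iff_less:
  fixes a b c d :: "'a::linorder"
  assumes "a < b" "c < d"
  shows "{a, b} = {c, d} \<longleftrightarrow> a = c \<and> b = d"
  using assms by (auto simp: doubleton_eq_iff)

text \<open>The vertices are the hubs \<open>0\<close> and \<open>1\<close>, the clique \<open>{2..<m + 2}\<close> and the independent set
  \<open>{m + 2..<n}\<close>.  Apart from the missing edges \<open>F\<close>, the hubs are joined to
  everything and to each other; each clique vertex \<open>p\<close> has the one neighbour \<open>f p\<close> in the independent set.\<close>

definition hub_edges :: "nat \<Rightarrow> nat \<Rightarrow> nat set set \<Rightarrow> (nat \<Rightarrow> nat) \<Rightarrow> nat set set" where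
  "hub_edges m n F f = ({e. e \<subseteq> {..<m + 2} \<and> card e = 2} - F)
     \<union> (\<lambda>s. {0, s}) ` {m + 2..<n} \<union> (\<lambda>s. {1, s}) ` {m + 2..<n} \<union> (\<lambda>p. {p, f p}) ` {2..<m + 2}"

text \<open>Only edges within \<open>{..<m + 2}\<close> may be missing.\<close>

locale two_hubs =
  fixes m r n :: nat and F :: "nat set set" and f :: "nat \<Rightarrow> nat"
  assumes n: "n = m + 2 + r" and r: "3 \<le> r"
    and F: "F \<subseteq> {e. e \<subseteq> {..<m + 2} \<and> card e = 2}"
    and f: "\<And>p. p \<in> {2..<m + 2} \<Longrightarrow> f p \<in> {m + 2..<n}"
begin

abbreviation V where "V \<equiv> {..<n}"
abbreviation E where "E \<equiv> hub_edges m n F f"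
abbreviation S where "S \<equiv> {m + 2..<n}"

lemma graph: "simple_graph V E"
  using f n F by (fastforce simp: simple_graph_def hub_edges_def card_insert_if)

lemma edge_iff:
  assumes "a < b"
  shows "{a, b} \<in> E \<longleftrightarrow> (if b < m + 2 then {a, b} \<notin> F
    else b < n \<and> (a < 2 \<or> a < m + 2 \<and> b = f a))"
proof -
  have f_ge: "m + 2 \<le> f p \<and> f p < n" if "2 \<le> p" "p < m + 2" for p using f[of p] that by auto
  have hub: "{a, b} \<in> (\<lambda>s. {c, s}) ` S \<longleftrightarrow> a = c \<and> b \<in> S" if "c < 2" for c
  proof
    assume "{a, b} \<in> (\<lambda>s. {c, s}) ` S"
    then obtain s where s: "s \<in> S" "{a, b} = {c, s}" by (rule imageE)
    have "c < s" using s(1) that by simp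
    with s(2) have "a = c \<and> b = s" by (simp only: pair_eq_iff_less[OF assms])
    then show "a = c \<and> b \<in> S" using s(1) by simp
  next
    assume "a = c \<and> b \<in> S"
    then show "{a, b} \<in> (\<lambda>s. {c, s}) ` S" by blast
  qed
  have 0: "{a, b} \<in> (\<lambda>s. {0, s}) ` S \<longleftrightarrow> a = 0 \<and> b \<in> S" by (rule hub) simp
  have 1: "{a, b} \<in> (\<lambda>s. {1, s}) ` S \<longleftrightarrow> a = 1 \<and> b \<in> S" by (rule hub) simp
  have 2: "{a, b} \<in> (\<lambda>p. {p, f p}) ` {2..<m + 2} \<longleftrightarrow> a \<in> {2..<m + 2} \<and> b = f a"
  proof
    assume "{a, b} \<in> (\<lambda>p. {p, f p}) ` {2..<m + 2}"
    then obtain p where p: "2 \<le> p" "p < m + 2" "{a, b} = {p, f p}" by auto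
    have "p < f p" using f_ge[OF p(1,2)] p(2) by linarith
    with p(3) have "a = p \<and> b = f p" by (simp only: pair_eq_iff_less[OF assms])
    then show "a \<in> {2..<m + 2} \<and> b = f a" using p by simp
  qed auto
  show ?thesis
    unfolding hub_edges_def Un_iff 0 1 2 Diff_iff mem_Collect_eq
    using assms f_ge[of a] by (auto simp: card_insert_if)
qed

lemma mem_nbhd:
  "v \<in> closed_nbhd V E u \<longleftrightarrow> v = u \<or>
    (if u < v then (if v < m + 2 then {u, v} \<notin> F else v < n \<and> (u < 2 \<or> u < m + 2 \<and> v = f u))
     else (if u < m + 2 then {v, u} \<notin> F else u < n \<and> (v < 2 \<or> v < m + 2 \<and> u = f v)))"
  unfolding mem_closed_nbhd[OF graph]
  using edge_iff[of u v] edge_iff[of v u]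
  by (cases u v rule: linorder_cases) (simp_all add: insert_commute)

lemma card_E: "card E + card F = ((m + 2) choose 2) + 2 * r + m"
proof -
  let ?A = "{e. e \<subseteq> {..<m + 2} \<and> card e = 2}"
  let ?B = "(\<lambda>s. {0, s}) ` S" and ?C = "(\<lambda>s. {1, s}) ` S" and ?D = "(\<lambda>p. {p, f p}) ` {2..<m + 2}"
  have fA: "finite ?A" by simp
  have A: "card (?A - F) + card F = (m + 2) choose 2"
    using F fA n_subsets[of "{..<m + 2}" 2] card_mono[OF fA F] finite_subset[OF F fA]
    by (simp add: card_Diff_subset)
  have B: "card ?B = r" "card ?C = r"
    using n by (subst card_image; auto simp: inj_on_def doubleton_eq_iff)+
  have "inj_on (\<lambda>p. {p, f p}) {2..<m + 2}"
    using f by (fastforce simp: inj_on_def doubleton_eq_iff)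
  then have D: "card ?D = m" by (simp add: card_image)
  have inB: "0 \<in> e \<and> \<not> e \<subseteq> {..<m + 2}" if "e \<in> ?B" for e using that by auto
  have inC: "1 \<in> e \<and> 0 \<notin> e \<and> \<not> e \<subseteq> {..<m + 2}" if "e \<in> ?C" for e using that by auto
  have inD: "0 \<notin> e \<and> 1 \<notin> e \<and> \<not> e \<subseteq> {..<m + 2}" if e: "e \<in> ?D" for e
  proof -
    obtain p where p: "p \<in> {2..<m + 2}" "e = {p, f p}" using e unfolding image_iff by blast
    then show ?thesis using f[OF p(1)] by auto
  qed
  have fin: "finite (?A - F)" "finite ?B" "finite ?C" "finite ?D" by auto
  have "(?A - F) \<inter> ?B = {}" using inB by blast
  then have 1: "card ((?A - F) \<union> ?B) = card (?A - F) + card ?B"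
    by (intro card_Un_disjoint fin)
  have "((?A - F) \<union> ?B) \<inter> ?C = {}" using inB inC by blast
  then have 2: "card ((?A - F) \<union> ?B \<union> ?C) = card ((?A - F) \<union> ?B) + card ?C"
    by (intro card_Un_disjoint finite_UnI fin)
  have "e \<notin> ?D" if e: "e \<in> (?A - F) \<union> ?B \<union> ?C" for e
  proof
    assume "e \<in> ?D"
    then have "0 \<notin> e" "1 \<notin> e" "\<not> e \<subseteq> {..<m + 2}" using inD[of e] by simp_all
    moreover from e have "e \<subseteq> {..<m + 2} \<or> 0 \<in> e \<or> 1 \<in> e"
    proof (elim UnE)
      assume "e \<in> ?B" then show ?thesis using inB[of e] by simp
    next
      assume "e \<in> ?C" then show ?thesis using inC[of e] by simp
    qed simp
    ultimately show False by simp
  qed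
  then have "((?A - F) \<union> ?B \<union> ?C) \<inter> ?D = {}" unfolding disjoint_iff by (intro allI impI)
  then have 3: "card ((?A - F) \<union> ?B \<union> ?C \<union> ?D) = card ((?A - F) \<union> ?B \<union> ?C) + card ?D"
    by (intro card_Un_disjoint finite_UnI fin)
  show ?thesis unfolding hub_edges_def 3 2 1 using A B D by linarith
qed

text \<open>By the hypotheses, a dominating set \<open>T\<close> with at most two overdominated vertices contains no hub
  and at most one clique vertex.  Since \<open>T\<close> has a clique vertex for each element of \<open>S\<close> that it omits,
  it has at least \<open>r\<close> elements, and at least two in \<open>S\<close>, which overdominate both hubs.\<close>

lemma optimum:
  assumes hubs: "\<And>u v. u < 2 \<Longrightarrow> v < n \<Longrightarrow> v \<noteq> u \<Longrightarrow>
      \<exists>A. card A = 3 \<and> A \<subseteq> closed_nbhd V E u \<inter> closed_nbhd V E v"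
    and not_universal: "\<And>u. u < 2 \<Longrightarrow> \<exists>v<n. v \<noteq> u \<and> {u, v} \<notin> E"
    and clique: "\<And>T p p'. dominating V E T \<Longrightarrow> p \<in> T \<Longrightarrow> p' \<in> T \<Longrightarrow> p \<noteq> p' \<Longrightarrow>
      p \<in> {2..<m + 2} \<Longrightarrow> p' \<in> {2..<m + 2} \<Longrightarrow> 0 \<notin> T \<Longrightarrow> 1 \<notin> T \<Longrightarrow> 3 \<le> CR_set V E T"
  shows "card E \<in> graph_sizes n 2 r"
proof -
  have SV: "S \<subseteq> V" by auto
  have hubE: "{0, s} \<in> E" "{1, s} \<in> E" if "s \<in> S" for s
    using edge_iff[of 0 s] edge_iff[of 1 s] that by auto
  have SE: "{s, t} \<notin> E" if "s \<in> S" "t \<in> S" for s t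
    using that edge_iff[of s t] edge_iff[of t s] edgeD[OF graph, of s t]
    by (cases s t rule: linorder_cases) (auto simp: insert_commute)
  have pE: "{p, s} \<in> E \<longleftrightarrow> s = f p" if "p \<in> {2..<m + 2}" "s \<in> S" for p s
    using edge_iff[of p s] that by auto
  have dom: "dominating V E S"
    unfolding dominating_iff[OF graph]
  proof (intro conjI ballI SV)
    fix v assume v: "v \<in> V"
    have "m + 2 \<in> S" using n r by simp
    moreover have "v = 0 \<or> v = 1 \<or> v \<in> {2..<m + 2} \<or> v \<in> S" using v by auto
    ultimately show "v \<in> S \<or> (\<exists>s\<in>S. {s, v} \<in> E)"
      using hubE pE f by (metis insert_commute)
  qed
  have "{u. overdominated V E S u} \<subseteq> {0, 1}"
  proof
    fix u assume "u \<in> {u. overdominated V E S u}"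
    then obtain s t where st: "s \<in> S" "t \<in> S" "s \<noteq> t"
      "s = u \<or> {u, s} \<in> E" "t = u \<or> {u, t} \<in> E" and u: "u \<in> V"
      unfolding mem_Collect_eq overdominated_iff[OF graph SV] by blast
    have "u \<notin> S" using st SE by blast
    moreover have "u \<notin> {2..<m + 2}"
    proof
      assume "u \<in> {2..<m + 2}"
      then show False using pE[of u s] pE[of u t] st by auto
    qed
    ultimately show "u \<in> {0, 1}" using u by auto
  qed
  then have "CR_set V E S \<le> card {0, 1 :: nat}"
    unfolding CR_set_def by (intro card_mono) auto
  then have CS: "CR_set V E S \<le> 2" by simp
  have lower: "CR_set V E T = 2 \<and> r \<le> card T"
    if T: "dominating V E T" and CT: "CR_set V E T \<le> 2" for T
  proof -
    have TV: "T \<subseteq> V" and Td: "\<And>v. v < n \<Longrightarrow> v \<in> T \<or> (\<exists>s\<in>T. {s, v} \<in> E)"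
      using T unfolding dominating_iff[OF graph] by auto
    have fT: "finite T" using TV finite_subset by blast
    have no_hub: "u \<notin> T" if u: "u < 2" for u
    proof
      assume uT: "u \<in> T"
      obtain v where v: "v < n" "v \<noteq> u" "{u, v} \<notin> E" using not_universal[OF u] by blast
      then obtain w where w: "w \<in> T" "w \<noteq> u" using Td[of v] by metis
      then have "w < n" using TV by auto
      then obtain A where "card A = 3" "A \<subseteq> closed_nbhd V E u \<inter> closed_nbhd V E w"
        using hubs[OF u _ w(2)] by blast
      then have "3 \<le> CR_set V E T"
        using card_common_nbhd_le[OF graph T uT w(1), of A] w(2) by simp
      then show False using CT by simp
    qed
    let ?P = "T \<inter> {2..<m + 2}"
    have "T = (T \<inter> S) \<union> ?P"
    proof
      show "T \<subseteq> (T \<inter> S) \<union> ?P"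
      proof
        fix t assume "t \<in> T"
        then show "t \<in> (T \<inter> S) \<union> ?P" using TV no_hub[of t] by (cases "t < 2") auto
      qed
    qed auto
    then have "card T = card ((T \<inter> S) \<union> ?P)" by simp
    also have "\<dots> = card (T \<inter> S) + card ?P" by (rule card_Un_disjoint) auto
    finally have cT: "card T = card (T \<inter> S) + card ?P" .
    have "S - T \<subseteq> f ` ?P"
    proof
      fix s assume s: "s \<in> S - T"
      then obtain t where t: "t \<in> T" "{t, s} \<in> E" using Td[of s] by auto
      have "t < n" using t TV by auto
      moreover have "\<not> t < 2" using no_hub t by blast
      moreover have "t \<notin> S" using SE t s by blast
      ultimately have "t \<in> {2..<m + 2}" by auto
      then show "s \<in> f ` ?P" using pE[of t s] t s by auto
    qed
    then have "card (S - T) \<le> card (f ` ?P)" by (intro card_mono) auto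
    also have "\<dots> \<le> card ?P" by (rule card_image_le) simp
    finally have ST: "card (S - T) \<le> card ?P" .
    have Sr: "card (T \<inter> S) + card (S - T) = r"
      using n card_Int_Diff[of S T] by (simp add: Int_commute)
    have "card ?P \<le> 1"
    proof (rule ccontr)
      assume "\<not> card ?P \<le> 1"
      then have "2 \<le> card ?P" by simp
      then obtain p p' where "p \<in> ?P" "p' \<in> ?P" "p \<noteq> p'"
        using card_ge_2_iff[of ?P] by auto
      then have "3 \<le> CR_set V E T"
        using clique[OF T, of p p'] no_hub[of 0] no_hub[of 1] by auto
      then show False using CT by simp
    qed
    then have "2 \<le> card (T \<inter> S)" using ST Sr r by simp
    then obtain s t where st: "s \<in> T" "t \<in> T" "s \<in> S" "t \<in> S" "s \<noteq> t"
      using card_ge_2_iff[of "T \<inter> S"] by auto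
    have "{0, 1} \<subseteq> closed_nbhd V E s \<inter> closed_nbhd V E t"
      using hubE[OF st(3)] hubE[OF st(4)] by (simp add: mem_closed_nbhd[OF graph] insert_commute)
    from card_common_nbhd_le[OF graph T st(1,2,5) this]
    have "2 \<le> CR_set V E T" by simp
    then show ?thesis using CT cT ST Sr by simp
  qed
  have cS: "card S = r" using n by simp
  have CS2: "CR_set V E S = 2" using CS lower[OF dom] by simp
  have "CR V E = 2" "gamma_CR V E = r"
    by (rule CR_gamma_eqI[OF graph dom CS2 cS lower]; assumption)+
  then show ?thesis
    unfolding graph_sizes_def using graph by (force intro: exI[of _ V])
qed

end

section \<open>The two kinds of missing edges\<close>

text \<open>Sends the clique vertices one by one to the vertices \<open>m + 2, m + 3, \<dots>\<close>,
  and all the remaining ones to the last vertex.\<close>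

definition spread :: "nat \<Rightarrow> nat \<Rightarrow> nat \<Rightarrow> nat" where
  "spread m r p = m + 2 + min (p - 2) (r - 1)"

text \<open>Only the edge between the hubs is missing.  Since \<open>r \<le> m\<close>, each vertex of the independent set has
  a neighbour in the clique, which is its third common closed neighbour with either hub.\<close>

lemma full_hubs_attains:
  assumes r3: "3 \<le> r" and rm: "r \<le> m"
  shows "2 * (r - 2) + ((m + 3) choose 2) + 1 \<in> graph_sizes (m + 2 + r) 2 r"
proof -
  define n where "n = m + 2 + r"
  interpret two_hubs m r n "{{0, 1}}" "spread m r"
    by unfold_locales (use r3 rm in \<open>auto simp: n_def spread_def\<close>)
  have n5: "m + 5 \<le> n" using r by (simp add: n_def)
  have f: "m + 2 \<le> spread m r p" "spread m r p < n" for p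
    using r by (auto simp: spread_def n_def)
  have mem: "v \<in> closed_nbhd V E u \<longleftrightarrow> v = u \<or>
      (if u < v then (if v < m + 2 then \<not> (u = 0 \<and> v = 1)
         else v < n \<and> (u < 2 \<or> u < m + 2 \<and> v = spread m r u))
       else (if u < m + 2 then \<not> (v = 0 \<and> u = 1)
         else u < n \<and> (v < 2 \<or> v < m + 2 \<and> u = spread m r v)))" for u v
    by (subst mem_nbhd) (auto simp: doubleton_eq_iff)
  have "card E \<in> graph_sizes n 2 r"
  proof (rule optimum)
    fix u v :: nat assume u: "u < 2" and v: "v < n" "v \<noteq> u"
    consider "v < 2" | "2 \<le> v" "v < m + 2" | "m + 2 \<le> v" by linarith
    then show "\<exists>A. card A = 3 \<and> A \<subseteq> closed_nbhd V E u \<inter> closed_nbhd V E v"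
    proof cases
      case 1
      then show ?thesis using u v r rm n5
        by (intro exI[of _ "{2, 3, 4}"]) (auto simp: mem simp del: One_nat_def)
    next
      case 2
      then show ?thesis using u v r f[of v]
        by (intro exI[of _ "{u, v, spread m r v}"]) (auto simp: mem simp del: One_nat_def)
    next
      case 3
      then have "spread m r (v - m) = v" using v rm by (auto simp: spread_def n_def)
      moreover have "2 \<le> v - m" "v - m < m + 2" using 3 v rm by (auto simp: n_def)
      ultimately show ?thesis using 3 u v
        by (intro exI[of _ "{u, v, v - m}"]) (auto simp: mem simp del: One_nat_def)
    qed
  next
    fix u :: nat assume "u < 2"
    then show "\<exists>v<n. v \<noteq> u \<and> {u, v} \<notin> E"
      using edge_iff[of 0 1] by (intro exI[of _ "1 - u"]) (auto simp: n_def less_2_cases_iff insert_commute)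
  next
    fix T p p' assume T: "dominating V E T" "p \<in> T" "p' \<in> T" "p \<noteq> p'"
      and p: "p \<in> {2..<m + 2}" "p' \<in> {2..<m + 2}"
    have "{0, 1, p} \<subseteq> closed_nbhd V E p \<inter> closed_nbhd V E p'"
      using p by (auto simp: mem simp del: One_nat_def)
    from card_common_nbhd_le[OF graph T this] p show "3 \<le> CR_set V E T" by auto
  qed
  moreover have "card E = 2 * (r - 2) + ((m + 3) choose 2) + 1"
    using card_E r choose_2_Suc[of "m + 2"] by (simp add: numeral_3_eq_3)
  ultimately show ?thesis by (simp add: n_def)
qed

text \<open>When \<open>r\<close> may exceed \<open>m\<close>, the hubs are joined to each other, and each hub misses one clique
  vertex, a different one for each.  These two clique vertices need care: they have only the clique
  as common closed neighbourhood, which has two elements if \<open>m = 2\<close>.\<close>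

lemma partial_hubs_attains:
  assumes r: "3 \<le> r" and m: "2 \<le> m"
  shows "2 * (r - 2) + ((m + 3) choose 2) \<in> graph_sizes (m + 2 + r) 2 r"
proof -
  define n where "n = m + 2 + r"
  interpret two_hubs m r n "{{0, 2}, {1, 3}}" "spread m r"
    by unfold_locales (use r m in \<open>auto simp: n_def spread_def\<close>)
  have n5: "m + 5 \<le> n" using r by (simp add: n_def)
  have f: "m + 2 \<le> spread m r p" "spread m r p < n" for p
    using r by (auto simp: spread_def n_def)
  have mem: "v \<in> closed_nbhd V E u \<longleftrightarrow> v = u \<or>
      (if u < v then (if v < m + 2 then \<not> (u = 0 \<and> v = 2) \<and> \<not> (u = 1 \<and> v = 3)
         else v < n \<and> (u < 2 \<or> u < m + 2 \<and> v = spread m r u))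
       else (if u < m + 2 then \<not> (v = 0 \<and> u = 2) \<and> \<not> (v = 1 \<and> u = 3)
         else u < n \<and> (v < 2 \<or> v < m + 2 \<and> u = spread m r v)))" for u v
    by (subst mem_nbhd) (auto simp: doubleton_eq_iff)
  have "card E \<in> graph_sizes n 2 r"
  proof (rule optimum)
    fix u v :: nat assume u: "u < 2" and v: "v < n" "v \<noteq> u"
    consider "v < 2" | "v = u + 2" | "2 \<le> v" "v < m + 2" "v \<noteq> u + 2" | "m + 2 \<le> v" by linarith
    then show "\<exists>A. card A = 3 \<and> A \<subseteq> closed_nbhd V E u \<inter> closed_nbhd V E v"
    proof cases
      case 1
      then show ?thesis using u v n5
        by (intro exI[of _ "{m + 2, m + 3, m + 4}"]) (auto simp: mem simp del: One_nat_def)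
    next
      case 2
      then show ?thesis using u v m f[of v]
        by (intro exI[of _ "{1 - u, 3 - u, spread m r v}"])
          (auto simp: mem less_2_cases_iff simp del: One_nat_def)
    next
      case 3
      then show ?thesis using u v f[of v]
        by (intro exI[of _ "{u, v, spread m r v}"]) (auto simp: mem less_2_cases_iff simp del: One_nat_def)
    next
      case 4
      then show ?thesis using u v m
        by (intro exI[of _ "{0, 1, v}"]) (auto simp: mem less_2_cases_iff simp del: One_nat_def)
    qed
  next
    fix u :: nat assume "u < 2"
    then show "\<exists>v<n. v \<noteq> u \<and> {u, v} \<notin> E"
    proof -
      have "{0, 2} \<notin> E" "{1, 3} \<notin> E" using edge_iff[of 0 2] edge_iff[of 1 3] m by simp_all
      moreover have "2 < n" "3 < n" "2 \<noteq> (0::nat)" "3 \<noteq> (1::nat)" using n5 by simp_all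
      moreover have "u = 0 \<or> u = 1" using \<open>u < 2\<close> by linarith
      ultimately show ?thesis by metis
    qed
  next
    fix T p p' assume T: "dominating V E T" "p \<in> T" "p' \<in> T" "p \<noteq> p'"
      and p: "p \<in> {2..<m + 2}" "p' \<in> {2..<m + 2}" and hubs: "0 \<notin> T" "1 \<notin> T"
    have big: "3 \<le> CR_set V E T" if a: "a \<in> T" "a \<in> {2..<m + 2}" "4 \<le> a"
      and b: "b \<in> T" "b \<in> {2..<m + 2}" "a \<noteq> b" for a b
    proof -
      have "{if b = 2 then 1 else 0, a, b} \<subseteq> closed_nbhd V E a \<inter> closed_nbhd V E b"
        using a b by (auto simp: mem simp del: One_nat_def)
      from card_common_nbhd_le[OF graph T(1) a(1) b(1,3) this] a b show ?thesis by auto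
    qed
    show "3 \<le> CR_set V E T"
    proof (cases "4 \<le> p \<or> 4 \<le> p'")
      case True
      then show ?thesis using big[of p p'] big[of p' p] T p by auto
    next
      case False
      moreover have "2 \<le> p" "2 \<le> p'" using p by simp_all
      ultimately have "p = 2 \<and> p' = 3 \<or> p = 3 \<and> p' = 2" using T(4) by linarith
      then have two: "2 \<in> T" "3 \<in> T" using T(2,3) by blast+
      have m23: "2 \<in> {2..<m + 2}" "3 \<in> {2..<m + 2}" using m by auto
      \<comment> \<open>The third vertex of the independent set is adjacent to neither \<open>2\<close> nor \<open>3\<close>, so \<open>T\<close> contains a
        further vertex, which creates a third overdominated one.\<close>
      define s where "s = m + 4"
      have s: "s \<in> S" "s \<noteq> spread m r 2" "s \<noteq> spread m r 3"
        using r by (auto simp: s_def n_def spread_def)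
      then have "s \<in> V" by simp
      then obtain t where t: "t \<in> T" "s \<in> closed_nbhd V E t"
        using T(1) unfolding dominating_def by blast
      have tn: "t < n" using t T(1) by (auto simp: dominating_def)
      have t01: "t \<noteq> 0" "t \<noteq> 1" using t(1) hubs by metis+
      have t23: "t \<noteq> 2" "t \<noteq> 3" using t s m by (auto simp: mem simp del: One_nat_def)
      show ?thesis
      proof (cases "t < m + 2")
        case True
        then have "4 \<le> t" "t \<in> {2..<m + 2}" using t01 t23 by auto
        then show ?thesis using big[of t 2] t two m23 by auto
      next
        case False
        have TV: "T \<subseteq> V" using T(1) by (simp add: dominating_def)
        have over: "overdominated V E T u"
          if "u \<in> V" "a \<in> T" "b \<in> T" "a \<noteq> b" "a = u \<or> {u, a} \<in> E" "b = u \<or> {u, b} \<in> E"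
          for u a b
          unfolding overdominated_iff[OF graph TV] using that by blast
        have "{0, 3} \<in> E" "{1, 2} \<in> E" "{2, 3} \<in> E" "{0, t} \<in> E" "{1, t} \<in> E"
          using m False tn edge_iff[of 0 3] edge_iff[of 1 2] edge_iff[of 2 3]
            edge_iff[of 0 t] edge_iff[of 1 t] by (simp_all add: doubleton_eq_iff)
        moreover have "0 \<in> V" "1 \<in> V" "2 \<in> V" using n5 by simp_all
        ultimately have "overdominated V E T 0" "overdominated V E T 1" "overdominated V E T 2"
          using over[of 0 3 t] over[of 1 2 t] over[of 2 2 3] t(1) t23 two by simp_all
        then have "{0, 1, 2} \<subseteq> {u. overdominated V E T u}" by simp
        from CR_set_ge[OF graph this] show ?thesis by simp
      qed
    qed
  qed
  moreover have "card E = 2 * (r - 2) + ((m + 3) choose 2)"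
  proof -
    have "card {{0, 2}, {1, 3::nat}} = 2" by (simp add: doubleton_eq_iff)
    then show ?thesis using card_E r choose_2_Suc[of "m + 2"] by (simp add: numeral_3_eq_3)
  qed
  ultimately show ?thesis by (simp add: n_def)
qed

section \<open>The extremal numbers\<close>

theorem theorem6p4:
  fixes n r :: nat
  assumes "n \<ge> 5"
  shows "(r = 2 \<longrightarrow> M n 2 r = ((n - 1) choose 2) + 1)
    \<and> (3 \<le> r \<and> r \<le> n - 4 \<and> n - r - 2 \<ge> r \<longrightarrow>
         M n 2 r = 2 * (r - 2) + ((n - r + 1) choose 2) + 1)
    \<and> (3 \<le> r \<and> r \<le> n - 4 \<and> n - r - 2 < r \<longrightarrow>
         M n 2 r = 2 * (r - 2) + ((n - r + 1) choose 2))
    \<and> (r = n - 3 \<longrightarrow> M n 2 r = 7)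
    \<and> (r = n - 2 \<longrightarrow> M n 2 r = 4)"
proof (intro conjI impI)
  assume "r = 2"
  have "n - n + 2 = r" using \<open>r = 2\<close> by simp
  then show "M n 2 r = ((n - 1) choose 2) + 1"
    using split_edges_attains[of n n] upper_bounds(1)[OF _ \<open>r = 2\<close>, of _ n] assms
    by (intro M_eqI) auto
next
  assume r: "3 \<le> r \<and> r \<le> n - 4 \<and> n - r - 2 \<ge> r"
  have eq: "n - r - 2 + 2 + r = n" "n - r - 2 + 3 = n - r + 1" using r assms by auto
  have "2 * (r - 2) + ((n - r + 1) choose 2) + 1 \<in> graph_sizes n 2 r"
    using full_hubs_attains[of r "n - r - 2"] r unfolding eq by blast
  then show "M n 2 r = 2 * (r - 2) + ((n - r + 1) choose 2) + 1"
    using r upper_bounds(2) by (intro M_eqI) blast+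
next
  assume r: "3 \<le> r \<and> r \<le> n - 4 \<and> n - r - 2 < r"
  have "2 \<le> n - r - 2" using r assms by linarith
  moreover have eq: "n - r - 2 + 2 + r = n" "n - r - 2 + 3 = n - r + 1" using r assms by auto
  ultimately have "2 * (r - 2) + ((n - r + 1) choose 2) \<in> graph_sizes n 2 r"
    using partial_hubs_attains[of r "n - r - 2"] r unfolding eq by blast
  then show "M n 2 r = 2 * (r - 2) + ((n - r + 1) choose 2)"
    using r upper_bounds(3) by (intro M_eqI) blast+
next
  assume r: "r = n - 3"
  then have rn: "r + 3 = n" "n - 5 + 2 = r" using assms by auto
  have "(5 - 1 choose 2) + 1 = (7::nat)" by (simp add: numeral_eq_Suc)
  then show "M n 2 r = 7"
    using split_edges_attains[of 5 n] assms rn upper_bounds(4)[OF _ rn(1)]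
    by (intro M_eqI) auto
next
  assume r: "r = n - 2"
  then have rn: "r + 2 = n" "n - 4 + 2 = r" using assms by auto
  have "(4 - 1 choose 2) + 1 = (4::nat)" by (simp add: numeral_eq_Suc)
  then show "M n 2 r = 4"
    using split_edges_attains[of 4 n] assms rn upper_bounds(5)[OF _ rn(1)]
    by (intro M_eqI) auto
qed

end
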